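(* In the setting described in the context, if there is a feasible solution of problem BPUP' for the instance $I'$ that uses $B$ bins, then the configuration linear program described in the context has a feasible solution of cost at most $B$.
   Context: BPUP: items with sizes $s_i\in[0,1]$, a rational $U\in(0,1]$, a positive integer $k$, bins of capacity 1; the load of a nonempty set $p$ in a bin is $\sum_{i\in p}s_i+\lfloor(|p|-1)/k\rfloor U$. Let $\varepsilon>0$ with $1/\varepsilon\in\mathbb{Z}$ and assume $\lfloor k/U\rfloor+k>1/\varepsilon^2$. An item is small if its size is $<\varepsilon$ and large otherwise. $I'$ is an instance consisting of a set $\mathcal{S}$ of small items and a set of large items (sizes $\ge\varepsilon$); $Z$ is the set of distinct large item sizes in $I'$ and $n(z)$ the number of large items of size $z$. Problem BPUP': for a bin $p$, sort its items in non-increasing size, ties broken by increasing index; the early items $E_p$ are the first $k/\varepsilon$ items, the late items $\Lambda_p$ are the rest. Late items have modified size $\tilde s_i=s_i+U/k$. The load of $p$ is $\sum_{i\in E_p}s_i+\sum_{i\in\Lambda_p}\tilde s_i+\frac{|E_p|}{k}U$ if $\Lambda_p\neq\emptyset$, and $\sum_{i\in E_p}s_i+\lfloor(|E_p|-1)/k\rfloor U$ otherwise. A feasible solution partitions the items of $I'$ into bins of load at most $1$. Configurations: $c$ consists of nonnegative integers $\alpha_{cz}$ ($z\in Z$), a nonnegative integer $\delta_c$, an integer $\gamma_c\in\{0,1,\dots,1/\varepsilon\}$ and a bit $\gamma'_c\in\{0,1\}$ (with $\gamma_c=0$ if $\gamma'_c=0$). Its load is $L_c=\sum_z\alpha_{cz}z+\gamma'_c\gamma_c\varepsilon+(\delta_c-1+\gamma'_c)U$,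 and $c$ is feasible if $L_c\le1$; $\mathcal{C}$ is the set of feasible configurations; put $\beta_c=1-L_c$. Let $H=\{0,1,\dots,1/\varepsilon\}$. The configuration LP has variables $u_c\ge0$ ($c\in\mathcal{C}$), $v_{i\eta},w_{i\eta}\ge0$ ($i\in\mathcal{S},\eta\in H$); it minimizes $\sum_c u_c$ subject to: $\sum_c u_c\alpha_{cz}\ge n(z)$ for all $z\in Z$; $\sum_{\eta\in H}(v_{i\eta}+w_{i\eta})\ge1$ for all $i\in\mathcal{S}$; for every $\eta\in H$: $\sum_{i\in\mathcal{S}}v_{i\eta}s_i\le\sum_{c:\gamma_c=\eta}u_c\beta_c$, $\ \sum_{i\in\mathcal{S}}w_{i\eta}\tilde s_i\le\sum_{c:\gamma_c=\eta}u_c\gamma'_c(\gamma_c+1)\varepsilon$, and $\sum_{c:\gamma_c=\eta}u_c\sum_z\alpha_{cz}+\sum_{i\in\mathcal{S}}v_{i\eta}\le\sum_{c:\gamma_c=\eta}u_c\delta_ck$. *)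

theory Defs
  imports Complex_Main "HOL-Library.Disjoint_Sets"
begin

text \<open>
  Items are natural-number indices: \<open>I\<close> is the finite set of items of the instance and \<open>s i\<close>
  is the size of item \<open>i\<close>.  The number \<open>1/\<epsilon>\<close> is assumed to be an integer wherever these
  definitions are used, so the floors below only convert \<open>1/\<epsilon>\<close> and \<open>k/\<epsilon>\<close> to type
  \<^typ>\<open>nat\<close>.
\<close>

definition small_items :: "nat set \<Rightarrow> (nat \<Rightarrow> real) \<Rightarrow> real \<Rightarrow> nat set" where
  "small_items I s \<epsilon> = {i \<in> I. s i < \<epsilon>}"

definition large_items :: "nat set \<Rightarrow> (nat \<Rightarrow> real) \<Rightarrow> real \<Rightarrow> nat set" where
  "large_items I s \<epsilon> = {i \<in> I. s i \<ge> \<epsilon>}"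

definition large_sizes :: "nat set \<Rightarrow> (nat \<Rightarrow> real) \<Rightarrow> real \<Rightarrow> real set" where
  "large_sizes I s \<epsilon> = s ` large_items I s \<epsilon>"

definition num_large :: "nat set \<Rightarrow> (nat \<Rightarrow> real) \<Rightarrow> real \<Rightarrow> real \<Rightarrow> nat" where
  "num_large I s \<epsilon> z = card {i \<in> large_items I s \<epsilon>. s i = z}"

definition modified_size :: "(nat \<Rightarrow> real) \<Rightarrow> real \<Rightarrow> nat \<Rightarrow> nat \<Rightarrow> real" where
  "modified_size s U k i = s i + U / real k"

text \<open>
  \<^const>\<open>sort_key\<close> is stable, hence items of equal size stay in the order of
  \<^const>\<open>sorted_list_of_set\<close>, that is, in increasing order of their indices.
\<close>

definition bin_order :: "(nat \<Rightarrow> real) \<Rightarrow> nat set \<Rightarrow> nat list" where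
  "bin_order s p = sort_key (\<lambda>i. - s i) (sorted_list_of_set p)"

definition early_items :: "(nat \<Rightarrow> real) \<Rightarrow> nat \<Rightarrow> real \<Rightarrow> nat set \<Rightarrow> nat set" where
  "early_items s k \<epsilon> p = set (take (nat \<lfloor>real k / \<epsilon>\<rfloor>) (bin_order s p))"

definition late_items :: "(nat \<Rightarrow> real) \<Rightarrow> nat \<Rightarrow> real \<Rightarrow> nat set \<Rightarrow> nat set" where
  "late_items s k \<epsilon> p = p - early_items s k \<epsilon> p"

definition bin_load :: "(nat \<Rightarrow> real) \<Rightarrow> real \<Rightarrow> nat \<Rightarrow> real \<Rightarrow> nat set \<Rightarrow> real" where
  "bin_load s U k \<epsilon> p =
    (if late_items s k \<epsilon> p \<noteq> {}
     then (\<Sum>i\<in>early_items s k \<epsilon> p. s i) + (\<Sum>i\<in>late_items s k \<epsilon> p. modified_size s U k i)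
            + real (card (early_items s k \<epsilon> p)) / real k * U
     else (\<Sum>i\<in>early_items s k \<epsilon> p. s i)
            + of_int \<lfloor>(real (card (early_items s k \<epsilon> p)) - 1) / real k\<rfloor> * U)"

definition feasible_packing ::
  "nat set \<Rightarrow> (nat \<Rightarrow> real) \<Rightarrow> real \<Rightarrow> nat \<Rightarrow> real \<Rightarrow> nat set set \<Rightarrow> bool" where
  "feasible_packing I s U k \<epsilon> P \<longleftrightarrow>
     partition_on I P \<and> (\<forall>p\<in>P. bin_load s U k \<epsilon> p \<le> 1)"

text \<open>
  The fields are $\alpha_{c\cdot}$, $\delta_c$, $\gamma_c$ and the bit $\gamma'_c$.
\<close>

datatype config =
  Config (cfg_alpha: "real \<Rightarrow> nat") (cfg_delta: nat) (cfg_gamma: nat) (cfg_gamma': bool)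

definition config_load :: "real set \<Rightarrow> real \<Rightarrow> real \<Rightarrow> config \<Rightarrow> real" where
  "config_load Z U \<epsilon> c =
     (\<Sum>z\<in>Z. real (cfg_alpha c z) * z)
     + of_bool (cfg_gamma' c) * real (cfg_gamma c) * \<epsilon>
     + (real (cfg_delta c) - 1 + of_bool (cfg_gamma' c)) * U"

definition config_beta :: "real set \<Rightarrow> real \<Rightarrow> real \<Rightarrow> config \<Rightarrow> real" where
  "config_beta Z U \<epsilon> c = 1 - config_load Z U \<epsilon> c"

definition gamma_range :: "real \<Rightarrow> nat set" where
  "gamma_range \<epsilon> = {0..nat \<lfloor>1 / \<epsilon>\<rfloor>}"

text \<open>
  The vector $(\alpha_{cz})_{z \in Z}$ is a total function on the reals, normalised to be \<open>0\<close>
  outside \<open>Z\<close>; without the normalisation the set of configurations would be infinite.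
\<close>

definition configs :: "real set \<Rightarrow> real \<Rightarrow> real \<Rightarrow> config set" where
  "configs Z U \<epsilon> =
     {c. (\<forall>z. z \<notin> Z \<longrightarrow> cfg_alpha c z = 0)
         \<and> cfg_gamma c \<in> gamma_range \<epsilon>
         \<and> (\<not> cfg_gamma' c \<longrightarrow> cfg_gamma c = 0)
         \<and> config_load Z U \<epsilon> c \<le> 1}"

lemma finite_configs:
  assumes "finite Z" "\<And>z. z \<in> Z \<Longrightarrow> \<epsilon> \<le> z" "0 < \<epsilon>" "0 < U"
  shows "finite (configs Z U \<epsilon>)"
proof -
  define N where "N = nat \<lfloor>(1 + U) / \<epsilon>\<rfloor>"
  define M where "M = nat \<lfloor>(1 + U) / U\<rfloor>"
  define A where "A = {f :: real \<Rightarrow> nat. \<forall>z. (z \<in> Z \<longrightarrow> f z \<in> {..N}) \<and> (z \<notin> Z \<longrightarrow> f z = 0)}"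
  have "finite A"
    unfolding A_def by (rule finite_set_of_finite_funs) (use assms in auto)
  have "configs Z U \<epsilon> \<subseteq>
      (\<lambda>(f, d, g, b). Config f d g b) ` (A \<times> {..M} \<times> gamma_range \<epsilon> \<times> UNIV)"
  proof
    fix c assume c: "c \<in> configs Z U \<epsilon>"
    define T where "T = (\<Sum>z\<in>Z. real (cfg_alpha c z) * z)"
    define b :: real where "b = of_bool (cfg_gamma' c)"
    have b: "0 \<le> b" by (simp add: b_def)
    have "0 \<le> b * real (cfg_gamma c) * \<epsilon>" "0 \<le> b * U"
      using b assms by auto
    moreover have "T + b * real (cfg_gamma c) * \<epsilon> + (real (cfg_delta c) - 1 + b) * U \<le> 1"
      using c by (simp add: configs_def config_load_def T_def b_def)
    ultimately have TU: "T + real (cfg_delta c) * U \<le> 1 + U"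
      by (simp add: algebra_simps)
    have nn: "0 \<le> real (cfg_alpha c z) * z" if "z \<in> Z" for z
      using assms(2)[OF that] assms(3) by simp
    have "0 \<le> T" unfolding T_def by (rule sum_nonneg) (use nn in auto)
    then have "real (cfg_delta c) * U \<le> 1 + U" using TU by simp
    then have "real (cfg_delta c) \<le> (1 + U) / U" using assms by (simp add: field_simps)
    then have d: "cfg_delta c \<le> M" unfolding M_def by linarith
    have a: "cfg_alpha c z \<le> N" if z: "z \<in> Z" for z
    proof -
      have "real (cfg_alpha c z) * \<epsilon> \<le> real (cfg_alpha c z) * z"
        using assms(2)[OF z] by (simp add: mult_left_mono)
      also have "\<dots> \<le> T"
        unfolding T_def using nn by (intro member_le_sum) (use z assms in auto)
      also have "\<dots> \<le> T + real (cfg_delta c) * U" using assms(4) by simp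
      also note TU
      finally have "real (cfg_alpha c z) \<le> (1 + U) / \<epsilon>" using assms by (simp add: field_simps)
      then show ?thesis unfolding N_def by linarith
    qed
    have "cfg_alpha c \<in> A" using a c by (auto simp: A_def configs_def)
    moreover have "cfg_gamma c \<in> gamma_range \<epsilon>" using c by (simp add: configs_def)
    ultimately show "c \<in> (\<lambda>(f, d, g, b). Config f d g b) ` (A \<times> {..M} \<times> gamma_range \<epsilon> \<times> UNIV)"
      using d by (intro image_eqI[of _ _ "(cfg_alpha c, cfg_delta c, cfg_gamma c, cfg_gamma' c)"]) auto
  qed
  then show ?thesis
    by (rule finite_subset) (use \<open>finite A\<close> in \<open>auto simp: gamma_range_def\<close>)
qed

definition config_LP_feasible ::
  "nat set \<Rightarrow> (nat \<Rightarrow> real) \<Rightarrow> real \<Rightarrow> nat \<Rightarrow> real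
    \<Rightarrow> (config \<Rightarrow> real) \<Rightarrow> (nat \<Rightarrow> nat \<Rightarrow> real) \<Rightarrow> (nat \<Rightarrow> nat \<Rightarrow> real) \<Rightarrow> bool" where
  "config_LP_feasible I s U k \<epsilon> u v w \<longleftrightarrow>
    (let Z = large_sizes I s \<epsilon>; S = small_items I s \<epsilon>; H = gamma_range \<epsilon>;
         C = configs Z U \<epsilon>
     in (\<forall>c\<in>C. u c \<ge> 0)
      \<and> (\<forall>i\<in>S. \<forall>\<eta>\<in>H. v i \<eta> \<ge> 0 \<and> w i \<eta> \<ge> 0)
      \<and> (\<forall>z\<in>Z. (\<Sum>c\<in>C. u c * real (cfg_alpha c z)) \<ge> real (num_large I s \<epsilon> z))
      \<and> (\<forall>i\<in>S. (\<Sum>\<eta>\<in>H. v i \<eta> + w i \<eta>) \<ge> 1)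
      \<and> (\<forall>\<eta>\<in>H. (\<Sum>i\<in>S. v i \<eta> * s i) \<le> (\<Sum>c\<in>{c \<in> C. cfg_gamma c = \<eta>}. u c * config_beta Z U \<epsilon> c))
      \<and> (\<forall>\<eta>\<in>H. (\<Sum>i\<in>S. w i \<eta> * modified_size s U k i)
            \<le> (\<Sum>c\<in>{c \<in> C. cfg_gamma c = \<eta>}.
                  u c * of_bool (cfg_gamma' c) * (real (cfg_gamma c) + 1) * \<epsilon>))
      \<and> (\<forall>\<eta>\<in>H. (\<Sum>c\<in>{c \<in> C. cfg_gamma c = \<eta>}. u c * (\<Sum>z\<in>Z. real (cfg_alpha c z)))
              + (\<Sum>i\<in>S. v i \<eta>)
            \<le> (\<Sum>c\<in>{c \<in> C. cfg_gamma c = \<eta>}. u c * real (cfg_delta c) * real k)))"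

definition config_LP_cost ::
  "nat set \<Rightarrow> (nat \<Rightarrow> real) \<Rightarrow> real \<Rightarrow> real \<Rightarrow> (config \<Rightarrow> real) \<Rightarrow> real" where
  "config_LP_cost I s U \<epsilon> u = (\<Sum>c\<in>configs (large_sizes I s \<epsilon>) U \<epsilon>. u c)"

end

theory Submission imports Defs begin

text \<open>
  Every bin of the packing becomes one configuration, with weight 1: \<open>\<alpha>\<close> counts the large items,
  \<open>\<delta> = \<lceil>|E| / k\<rceil>\<close>, and \<open>\<gamma>\<close> is the total modified size of the late items in
  units of \<open>\<epsilon>\<close>, rounded down.  A small item gets \<open>v = 1\<close> if it is early and \<open>w = 1\<close>
  if it is late.  The point to check is that late items are small: otherwise all \<open>k / \<epsilon>\<close> early
  items have size at least \<open>\<epsilon>\<close>, and already fill the bin.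
\<close>

section \<open>The sorted order of a bin, its early items and its late items\<close>

lemma set_bin_order: "finite p \<Longrightarrow> set (bin_order s p) = p"
  by (simp add: bin_order_def)

lemma distinct_bin_order: "distinct (bin_order s p)"
  by (simp add: bin_order_def)

lemma length_bin_order: "length (bin_order s p) = card p"
  by (simp add: bin_order_def)

lemma sorted_bin_order: "sorted (map (\<lambda>i. - s i) (bin_order s p))"
  by (simp add: bin_order_def)

lemma early_items_subset: "finite p \<Longrightarrow> early_items s k \<epsilon> p \<subseteq> p"
  using set_take_subset[of _ "bin_order s p"] by (auto simp: early_items_def set_bin_order)

lemma early_Un_late_items: "finite p \<Longrightarrow> early_items s k \<epsilon> p \<union> late_items s k \<epsilon> p = p"
  using early_items_subset[of p] by (auto simp: late_items_def)

lemma card_early_items: "card (early_items s k \<epsilon> p) = min (card p) (nat \<lfloor>real k / \<epsilon>\<rfloor>)"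
  by (simp add: early_items_def distinct_card distinct_bin_order length_bin_order)

text \<open>The early items form a prefix of \<open>bin_order\<close> and the late ones lie in the
  remaining suffix. The sort keys are negated sizes, so sizes cannot grow from prefix to
  suffix.\<close>

lemma late_items_le_early_items:
  assumes "finite p" "i \<in> late_items s k \<epsilon> p" "j \<in> early_items s k \<epsilon> p"
  shows "s i \<le> s j"
proof -
  define xs ys where "xs = take (nat \<lfloor>real k / \<epsilon>\<rfloor>) (bin_order s p)"
    and "ys = drop (nat \<lfloor>real k / \<epsilon>\<rfloor>) (bin_order s p)"
  have "bin_order s p = xs @ ys" by (simp add: xs_def ys_def)
  then have "sorted (map (\<lambda>i. - s i) (xs @ ys))" and "p = set xs \<union> set ys"
    using sorted_bin_order[of s p] set_bin_order[OF assms(1), of s] by simp_all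
  moreover have "early_items s k \<epsilon> p = set xs" by (simp add: early_items_def xs_def)
  ultimately show ?thesis
    using assms(2,3) by (force simp: late_items_def sorted_append)
qed

text \<open>Turns the floor in the load of a bin without late items into \<delta> - 1. With m the
  ceiling of e/k, the strict inequality (m - 1) k < e is between integers, hence (m - 1) k \<le> e -
  1.\<close>

lemma floor_diff_one_divide:
  assumes "0 < k"
  shows "\<lfloor>(real e - 1) / real k\<rfloor> = \<lceil>real e / real k\<rceil> - 1"
proof -
  define m where "m = \<lceil>real e / real k\<rceil>"
  have m: "of_int m - 1 < real e / real k" "real e / real k \<le> of_int m"
    using ceiling_correct[of "real e / real k"] unfolding m_def by simp_all
  have "real e \<le> of_int m * real k"
    using m(2) assms by (simp add: pos_divide_le_eq)
  moreover have "of_int (m - 1) * real k < real e"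
    using m(1) assms by (simp add: pos_less_divide_eq)
  then have "of_int ((m - 1) * int k) < (of_int (int e) :: real)" by simp
  then have "(m - 1) * int k + 1 \<le> int e" unfolding of_int_less_iff by simp
  then have "of_int ((m - 1) * int k + 1) \<le> (of_int (int e) :: real)" unfolding of_int_le_iff .
  then have "of_int (m - 1) * real k + 1 \<le> real e" by simp
  ultimately show ?thesis
    unfolding m_def[symmetric] using assms by (intro floor_unique) (auto simp: field_simps)
qed

text \<open>The ceiling serves two purposes: \<delta> k bounds the number of early items, and
  \<delta> - 1 is the floor in the load of a bin without late items.
  \<open>num_large p s \<epsilon>\<close> vanishes at sizes that no large item of \<open>p\<close>
  has, which fits the normalisation in \<open>configs\<close>.\<close>

definition bin_config :: "(nat \<Rightarrow> real) \<Rightarrow> real \<Rightarrow> nat \<Rightarrow> real \<Rightarrow> nat set \<Rightarrow> config" where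
  "bin_config s U k \<epsilon> p =
     Config (num_large p s \<epsilon>)
       (nat \<lceil>real (card (early_items s k \<epsilon> p)) / real k\<rceil>)
       (nat \<lfloor>(\<Sum>i\<in>late_items s k \<epsilon> p. modified_size s U k i) / \<epsilon>\<rfloor>)
       (late_items s k \<epsilon> p \<noteq> {})"

text \<open>Large items are grouped by size; sizes in \<open>Z\<close> missing from \<open>p\<close>
  contribute 0. The constant 1 for \<open>f\<close> counts large items, the identity adds up their
  sizes.\<close>

lemma sum_num_large:
  fixes f :: "real \<Rightarrow> real"
  assumes "finite p" "finite Z" "large_sizes p s \<epsilon> \<subseteq> Z"
  shows "(\<Sum>z\<in>Z. real (num_large p s \<epsilon> z) * f z) = (\<Sum>i\<in>large_items p s \<epsilon>. f (s i))"
proof -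
  have "(\<Sum>i\<in>large_items p s \<epsilon>. f (s i))
      = (\<Sum>z\<in>Z. \<Sum>i\<in>{i \<in> large_items p s \<epsilon>. s i = z}. f (s i))"
    using assms by (intro sum.group[symmetric]) (auto simp: large_sizes_def large_items_def)
  also have "\<dots> = (\<Sum>z\<in>Z. real (num_large p s \<epsilon> z) * f z)"
    by (simp add: num_large_def)
  finally show ?thesis by simp
qed

section \<open>Integrality of 1/\<epsilon> and the number of early items\<close>

locale bpup =
  fixes s :: "nat \<Rightarrow> real" and U \<epsilon> :: real and k :: nat
  assumes U_pos: "0 < U" and k_pos: "0 < k" and eps_pos: "0 < \<epsilon>"
    and inverse_eps_Ints: "1 / \<epsilon> \<in> \<int>"
begin

lemma real_nat_floor_k_eps: "real (nat \<lfloor>real k / \<epsilon>\<rfloor>) = real k / \<epsilon>"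
proof -
  have "real k / \<epsilon> = real k * (1 / \<epsilon>)" by simp
  also have "\<dots> \<in> \<int>" using inverse_eps_Ints by (intro Ints_mult) auto
  finally show ?thesis using eps_pos by (auto elim!: Ints_cases)
qed

text \<open>If a late item exists, the early items are a proper subset of \<open>p\<close>, so the
  minimum in \<open>card_early_items\<close> is the threshold.\<close>

lemma card_early_items_eq:
  assumes "finite p" "late_items s k \<epsilon> p \<noteq> {}"
  shows "real (card (early_items s k \<epsilon> p)) = real k / \<epsilon>"
proof -
  have "early_items s k \<epsilon> p \<subset> p"
    using assms early_items_subset[of p s k \<epsilon>] by (auto simp: late_items_def)
  then have "card (early_items s k \<epsilon> p) < card p" using psubset_card_mono[OF assms(1)] by simp
  then show ?thesis using real_nat_floor_k_eps by (simp add: card_early_items min_def split: if_splits)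
qed

section \<open>A single nonempty bin of load at most 1 and its configuration\<close>

context
  fixes p :: "nat set"
  assumes fin: "finite p" and ne: "p \<noteq> {}" and nonneg: "\<And>i. i \<in> p \<Longrightarrow> 0 \<le> s i"
    and load: "bin_load s U k \<epsilon> p \<le> 1"
begin

lemma fin_late: "finite (late_items s k \<epsilon> p)"
  using fin by (simp add: late_items_def)

text \<open>Brings both cases of the load into the shape of \<open>config_load\<close>. Without late
  items the floor is \<delta> - 1. With late items \<delta> = |E|/k = 1/\<epsilon> without rounding,
  and the bit cancels the -1.\<close>

lemma bin_load_eq:
  "bin_load s U k \<epsilon> p =
     (\<Sum>i\<in>early_items s k \<epsilon> p. s i) + (\<Sum>i\<in>late_items s k \<epsilon> p. modified_size s U k i)
     + (real (cfg_delta (bin_config s U k \<epsilon> p)) - 1 + of_bool (cfg_gamma' (bin_config s U k \<epsilon> p))) * U"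
proof (cases "late_items s k \<epsilon> p = {}")
  case True
  then show ?thesis
    by (simp add: bin_load_def bin_config_def floor_diff_one_divide[OF k_pos] of_nat_nat)
next
  case False
  have "real (card (early_items s k \<epsilon> p)) / real k = 1 / \<epsilon>"
    using card_early_items_eq[OF fin False] k_pos by simp
  moreover have "real (nat \<lceil>1 / \<epsilon>\<rceil>) = 1 / \<epsilon>"
    using inverse_eps_Ints eps_pos by (auto elim!: Ints_cases)
  ultimately have "real (cfg_delta (bin_config s U k \<epsilon> p)) = real (card (early_items s k \<epsilon> p)) / real k"
    by (simp only: bin_config_def config.sel)
  moreover have "cfg_gamma' (bin_config s U k \<epsilon> p)" using False by (simp add: bin_config_def)
  ultimately show ?thesis using False by (simp add: bin_load_def)
qed

lemma late_modified_size_pos: "i \<in> late_items s k \<epsilon> p \<Longrightarrow> 0 < modified_size s U k i"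
  using nonneg U_pos k_pos by (simp add: late_items_def modified_size_def add_nonneg_pos)

lemma late_load_nonneg: "0 \<le> (\<Sum>i\<in>late_items s k \<epsilon> p. modified_size s U k i)"
  using late_modified_size_pos by (intro sum_nonneg) (simp add: less_imp_le)

lemma early_load_nonneg: "0 \<le> (\<Sum>i\<in>early_items s k \<epsilon> p. s i)"
  using nonneg early_items_subset[OF fin] by (intro sum_nonneg) blast

text \<open>The threshold k/\<epsilon> is positive, so a nonempty bin has an early item. This keeps
  the factor of \<open>U\<close> in the load nonnegative.\<close>

lemma delta_pos: "1 \<le> cfg_delta (bin_config s U k \<epsilon> p)"
proof -
  have "0 < real k / \<epsilon>" using k_pos eps_pos by simp
  then have "0 < nat \<lfloor>real k / \<epsilon>\<rfloor>" using real_nat_floor_k_eps by (metis of_nat_0_less_iff)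
  then have "0 < card (early_items s k \<epsilon> p)"
    using fin ne by (simp add: card_early_items card_gt_0_iff)
  then have "0 < real (card (early_items s k \<epsilon> p)) / real k"
    using k_pos by simp
  then have "0 < \<lceil>real (card (early_items s k \<epsilon> p)) / real k\<rceil>"
    by (simp only: zero_less_ceiling)
  then show ?thesis unfolding bin_config_def config.sel by linarith
qed

lemma early_late_load_le:
  "(\<Sum>i\<in>early_items s k \<epsilon> p. s i) + (\<Sum>i\<in>late_items s k \<epsilon> p. modified_size s U k i) \<le> 1"
proof -
  have "0 \<le> (real (cfg_delta (bin_config s U k \<epsilon> p)) - 1
      + of_bool (cfg_gamma' (bin_config s U k \<epsilon> p))) * U"
    using delta_pos U_pos by (intro mult_nonneg_nonneg) auto
  then show ?thesis using load unfolding bin_load_eq by linarith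
qed

lemma late_items_small:
  assumes "i \<in> late_items s k \<epsilon> p"
  shows "s i < \<epsilon>"
proof (rule ccontr)
  assume "\<not> s i < \<epsilon>"
  then have "\<epsilon> \<le> s j" if "j \<in> early_items s k \<epsilon> p" for j
    using late_items_le_early_items[OF fin assms that] by simp
  then have "real (card (early_items s k \<epsilon> p)) * \<epsilon> \<le> (\<Sum>i\<in>early_items s k \<epsilon> p. s i)"
    by (intro sum_bounded_below) auto
  moreover have "real (card (early_items s k \<epsilon> p)) * \<epsilon> = real k"
    using card_early_items_eq[OF fin] assms eps_pos by (simp add: ex_in_conv[symmetric] exI[of _ i])
  \<comment> \<open>The early sizes alone give only a total of at least k \<ge> 1; the positive
    modified size of the late item pushes it strictly above 1.\<close>
  moreover have "0 < (\<Sum>i\<in>late_items s k \<epsilon> p. modified_size s U k i)"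
    using assms fin_late late_modified_size_pos by (intro sum_pos) auto
  ultimately show False using early_late_load_le k_pos by simp
qed

text \<open>Every item is early or late and no late item is large, so all large items are
  early.\<close>

lemma early_items_eq:
  "early_items s k \<epsilon> p = large_items p s \<epsilon> \<union> (small_items p s \<epsilon> \<inter> early_items s k \<epsilon> p)"
  using late_items_small early_Un_late_items[OF fin, of s k \<epsilon>]
  by (force simp: large_items_def small_items_def)

lemma sum_early_items:
  fixes f :: "nat \<Rightarrow> real"
  shows "(\<Sum>i\<in>early_items s k \<epsilon> p. f i)
    = (\<Sum>i\<in>large_items p s \<epsilon>. f i) + (\<Sum>i\<in>small_items p s \<epsilon> \<inter> early_items s k \<epsilon> p. f i)"
  by (subst early_items_eq, rule sum.union_disjoint)
     (use fin in \<open>auto simp: large_items_def small_items_def\<close>)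

lemma gamma_bounds:
  defines "\<gamma> \<equiv> real (cfg_gamma (bin_config s U k \<epsilon> p))"
  shows "\<gamma> * \<epsilon> \<le> (\<Sum>i\<in>late_items s k \<epsilon> p. modified_size s U k i)"
    and "(\<Sum>i\<in>late_items s k \<epsilon> p. modified_size s U k i) < (\<gamma> + 1) * \<epsilon>"
proof -
  define x where "x = (\<Sum>i\<in>late_items s k \<epsilon> p. modified_size s U k i) / \<epsilon>"
  have "0 \<le> x" using late_load_nonneg eps_pos by (simp add: x_def)
  moreover have "\<gamma> = real (nat \<lfloor>x\<rfloor>)" by (simp add: \<gamma>_def bin_config_def x_def)
  ultimately have "\<gamma> \<le> x" "x < \<gamma> + 1" by linarith+
  then show "\<gamma> * \<epsilon> \<le> (\<Sum>i\<in>late_items s k \<epsilon> p. modified_size s U k i)"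
    and "(\<Sum>i\<in>late_items s k \<epsilon> p. modified_size s U k i) < (\<gamma> + 1) * \<epsilon>"
    using eps_pos by (simp_all add: x_def field_simps)
qed

text \<open>Rounding down loses less than one unit \<epsilon>, whence the \<gamma> + 1 in the LP
  capacity. Without late items both sides are 0.\<close>

lemma bin_config_late:
  "(\<Sum>i\<in>late_items s k \<epsilon> p. modified_size s U k i)
    \<le> of_bool (cfg_gamma' (bin_config s U k \<epsilon> p))
        * (real (cfg_gamma (bin_config s U k \<epsilon> p)) + 1) * \<epsilon>"
proof (cases "late_items s k \<epsilon> p = {}")
  case False
  then have "cfg_gamma' (bin_config s U k \<epsilon> p)" by (simp add: bin_config_def)
  then show ?thesis using gamma_bounds(2) by simp
qed (simp add: bin_config_def)

text \<open>The left side counts the early items, since all large items are among them; the ceiling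
  in \<delta> does the rest.\<close>

lemma bin_config_count:
  assumes "finite Z" "large_sizes p s \<epsilon> \<subseteq> Z"
  shows "(\<Sum>z\<in>Z. real (cfg_alpha (bin_config s U k \<epsilon> p) z))
      + (\<Sum>i\<in>small_items p s \<epsilon> \<inter> early_items s k \<epsilon> p. 1)
    \<le> real (cfg_delta (bin_config s U k \<epsilon> p)) * real k"
proof -
  have "(\<Sum>z\<in>Z. real (cfg_alpha (bin_config s U k \<epsilon> p) z))
      + (\<Sum>i\<in>small_items p s \<epsilon> \<inter> early_items s k \<epsilon> p. 1) = (\<Sum>i\<in>early_items s k \<epsilon> p. 1)"
    using sum_num_large[OF fin assms, of "\<lambda>_. 1"]
    by (simp add: sum_early_items[of "\<lambda>_. 1", simplified] bin_config_def)
  also have "\<dots> \<le> real (cfg_delta (bin_config s U k \<epsilon> p)) * real k"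
    using real_nat_ceiling_ge[of "real (card (early_items s k \<epsilon> p)) / real k"] k_pos
    unfolding bin_config_def config.sel by (simp only: pos_divide_le_eq of_nat_0_less_iff) simp
  finally show ?thesis .
qed

text \<open>Bin load and configuration load share the \<open>U\<close> term and the large sizes, and
  \<gamma> \<epsilon> only underestimates the late load. What the bin holds in addition is the small
  early items, which therefore fit into the slack.\<close>

lemma bin_config_beta:
  assumes "finite Z" "large_sizes p s \<epsilon> \<subseteq> Z"
  shows "(\<Sum>i\<in>small_items p s \<epsilon> \<inter> early_items s k \<epsilon> p. s i)
    \<le> config_beta Z U \<epsilon> (bin_config s U k \<epsilon> p)"
proof -
  let ?c = "bin_config s U k \<epsilon> p"
  have "(\<Sum>z\<in>Z. real (cfg_alpha ?c z) * z) = (\<Sum>i\<in>large_items p s \<epsilon>. s i)"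
    using sum_num_large[OF fin assms, of "\<lambda>z. z"] by (simp add: bin_config_def)
  moreover have "of_bool (cfg_gamma' ?c) * real (cfg_gamma ?c) * \<epsilon>
      \<le> (\<Sum>i\<in>late_items s k \<epsilon> p. modified_size s U k i)"
    using gamma_bounds(1) late_load_nonneg by (cases "cfg_gamma' ?c") auto
  ultimately show ?thesis
    using load unfolding bin_load_eq config_beta_def config_load_def sum_early_items by linarith
qed

text \<open>The late load is at most 1, which bounds \<gamma> by 1/\<epsilon>. The slack is at least
  a sum of nonnegative sizes, so the configuration load is at most 1.\<close>

lemma bin_config_in_configs:
  assumes "finite Z" "large_sizes p s \<epsilon> \<subseteq> Z"
  shows "bin_config s U k \<epsilon> p \<in> configs Z U \<epsilon>"
proof -
  let ?c = "bin_config s U k \<epsilon> p"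
  have "cfg_alpha ?c z = 0" if "z \<notin> Z" for z
  proof -
    have "{i \<in> large_items p s \<epsilon>. s i = z} = {}"
      using that assms(2) by (auto simp: large_sizes_def)
    then show ?thesis by (simp only: bin_config_def config.sel num_large_def card.empty)
  qed
  moreover have "cfg_gamma ?c \<in> gamma_range \<epsilon>"
  proof -
    have "real (cfg_gamma ?c) * \<epsilon> \<le> 1"
      using gamma_bounds(1) early_late_load_le early_load_nonneg by linarith
    then have "real (cfg_gamma ?c) \<le> 1 / \<epsilon>" using eps_pos by (simp add: field_simps)
    then show ?thesis using le_nat_floor by (simp add: gamma_range_def)
  qed
  moreover have "cfg_gamma ?c = 0" if "\<not> cfg_gamma' ?c"
    using that by (simp add: bin_config_def)
  moreover have "config_load Z U \<epsilon> ?c \<le> 1"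
  proof -
    have "0 \<le> (\<Sum>i\<in>small_items p s \<epsilon> \<inter> early_items s k \<epsilon> p. s i)"
      using nonneg by (intro sum_nonneg) (simp add: small_items_def)
    then show ?thesis using bin_config_beta[OF assms] by (simp add: config_beta_def)
  qed
  ultimately show ?thesis by (simp add: configs_def)
qed

end

end

text \<open>Converts sums over configurations, weighted by how many bins \<open>g\<close> maps to
  each, into sums over bins.\<close>

lemma sum_card_fibre:
  fixes f :: "'b \<Rightarrow> real"
  assumes "finite P" "finite D"
  shows "(\<Sum>c\<in>D. real (card {p \<in> P. g p = c}) * f c) = (\<Sum>p\<in>{p \<in> P. g p \<in> D}. f (g p))"
proof -
  have "(\<Sum>p\<in>{p \<in> P. g p \<in> D}. f (g p))
      = (\<Sum>c\<in>D. \<Sum>p\<in>{q \<in> {p \<in> P. g p \<in> D}. g q = c}. f (g p))"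
    using assms by (intro sum.group[symmetric]) auto
  also have "\<dots> = (\<Sum>c\<in>D. real (card {p \<in> P. g p = c}) * f c)"
    \<comment> \<open>On the fibre over \<open>c\<close> the summand is the constant
      \<open>f c\<close>; as \<open>c\<close> lies in \<open>D\<close>, restricting to
      \<open>g p \<in> D\<close> does not shrink that fibre.\<close>
    by (intro sum.cong refl, subst sum.cong[OF refl, of _ _ "\<lambda>_. f _"])
       (auto intro!: arg_cong[where f = card])
  finally show ?thesis by simp
qed

text \<open>Double counting of the pairs of an item and a set \<open>A p\<close> containing
  it.\<close>

lemma sum_card_member:
  fixes f :: "'a \<Rightarrow> real"
  assumes "finite S" "finite Q"
  shows "(\<Sum>i\<in>S. real (card {p \<in> Q. i \<in> A p}) * f i) = (\<Sum>p\<in>Q. \<Sum>i\<in>S \<inter> A p. f i)"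
proof -
  have "(\<Sum>i\<in>S. real (card {p \<in> Q. i \<in> A p}) * f i) = (\<Sum>i\<in>S. \<Sum>p\<in>Q. if i \<in> A p then f i else 0)"
    using assms by (simp add: sum.If_cases Int_def)
  also have "\<dots> = (\<Sum>p\<in>Q. \<Sum>i\<in>S. if i \<in> A p then f i else 0)" by (rule sum.swap)
  also have "\<dots> = (\<Sum>p\<in>Q. \<Sum>i\<in>S \<inter> A p. f i)"
    using assms by (simp add: sum.If_cases)
  finally show ?thesis .
qed

section \<open>Assembling the LP solution from all bins\<close>

theorem theorem5:
  fixes I :: "nat set" and s :: "nat \<Rightarrow> real" and U \<epsilon> :: real and k B :: nat
    and P :: "nat set set"
  assumes "finite I"
    and "\<And>i. i \<in> I \<Longrightarrow> 0 \<le> s i \<and> s i \<le> 1"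
    and "U \<in> \<rat>" and "0 < U" and "U \<le> 1"
    and "0 < k"
    and "0 < \<epsilon>" and "1 / \<epsilon> \<in> \<int>"
    and "real_of_int \<lfloor>real k / U\<rfloor> + real k > 1 / \<epsilon>\<^sup>2"
    and "feasible_packing I s U k \<epsilon> P"
    and "card P = B"
  shows "\<exists>u v w. config_LP_feasible I s U k \<epsilon> u v w \<and> config_LP_cost I s U \<epsilon> u \<le> real B"
proof -
  interpret bpup s U \<epsilon> k using assms by unfold_locales
  define Z S H where "Z = large_sizes I s \<epsilon>" and "S = small_items I s \<epsilon>"
    and "H = gamma_range \<epsilon>"
  define C where "C = configs Z U \<epsilon>"
  define cf where "cf = bin_config s U k \<epsilon>"
  define E \<Lambda> where "E = early_items s k \<epsilon>" and "\<Lambda> = late_items s k \<epsilon>"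
  have part: "partition_on I P" using assms by (simp add: feasible_packing_def)
  have finP: "finite P" using part assms(1) by (rule finite_elements[rotated])
  have finZ: "finite Z" using assms(1) by (simp add: Z_def large_sizes_def large_items_def)
  have finS: "finite S" using assms(1) by (simp add: S_def small_items_def)
  have finH: "finite H" by (simp add: H_def gamma_range_def)
  have finC: "finite C"
    unfolding C_def using finZ assms
    by (intro finite_configs) (auto simp: Z_def large_sizes_def large_items_def)
  have bin: "finite p" "p \<noteq> {}" "\<And>i. i \<in> p \<Longrightarrow> 0 \<le> s i" "bin_load s U k \<epsilon> p \<le> 1"
    "large_sizes p s \<epsilon> \<subseteq> Z" and sub: "p \<subseteq> I" if "p \<in> P" for p
  proof -
    show sub: "p \<subseteq> I" using part that by (auto simp: partition_on_def)
    then show "finite p" using assms(1) by (rule finite_subset)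
    show "p \<noteq> {}" using part that by (auto simp: partition_on_def)
    show "\<And>i. i \<in> p \<Longrightarrow> 0 \<le> s i" using sub assms(2) by auto
    show "bin_load s U k \<epsilon> p \<le> 1" using assms that by (simp add: feasible_packing_def)
    show "large_sizes p s \<epsilon> \<subseteq> Z" using sub by (auto simp: Z_def large_sizes_def large_items_def)
  qed
  have early: "E p \<subseteq> p" if "p \<in> P" for p
    unfolding E_def using bin(1)[OF that] by (rule early_items_subset)
  have late: "i \<in> p \<and> s i < \<epsilon>" if "p \<in> P" "i \<in> \<Lambda> p" for p i
    using late_items_small[OF bin(1-4)[OF that(1)]] that(2) by (simp add: \<Lambda>_def late_items_def)
  have cfC: "cf p \<in> C" if "p \<in> P" for p
    unfolding cf_def C_def using bin(1-4)[OF that] finZ bin(5)[OF that] by (rule bin_config_in_configs)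
  have cfH: "cfg_gamma (cf p) \<in> H" if "p \<in> P" for p
    using cfC[OF that] by (simp add: C_def configs_def H_def)

  \<comment> \<open>Several bins may yield the same configuration, so its weight is a
    multiplicity.\<close>
  define u where "u c = real (card {p \<in> P. cf p = c})" for c
  define Q where "Q \<eta> = {p \<in> P. cfg_gamma (cf p) = \<eta>}" for \<eta>
  \<comment> \<open>Bins are disjoint, so \<open>v\<close> and \<open>w\<close> take only the values
    0 and 1; the cardinality form fits \<open>sum_card_member\<close>.\<close>
  define v where "v i \<eta> = real (card {p \<in> Q \<eta>. i \<in> E p})" for i \<eta>
  define w where "w i \<eta> = real (card {p \<in> Q \<eta>. i \<in> \<Lambda> p})" for i \<eta>
  have finQ: "finite (Q \<eta>)" for \<eta> using finP by (simp add: Q_def)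
  have sum_u: "(\<Sum>c\<in>C. u c * f c) = (\<Sum>p\<in>P. f (cf p))" for f
    unfolding u_def sum_card_fibre[OF finP finC] using cfC by (intro sum.cong) auto
  have sum_uQ: "(\<Sum>c\<in>{c \<in> C. cfg_gamma c = \<eta>}. u c * f c) = (\<Sum>p\<in>Q \<eta>. f (cf p))" for f \<eta>
    unfolding u_def using cfC finC
    by (subst sum_card_fibre[OF finP]) (auto simp: Q_def intro!: sum.cong)
  have sum_v: "(\<Sum>i\<in>S. v i \<eta> * f i) = (\<Sum>p\<in>Q \<eta>. \<Sum>i\<in>small_items p s \<epsilon> \<inter> E p. f i)" for f \<eta>
    unfolding v_def sum_card_member[OF finS finQ]
  proof (intro sum.cong refl)
    fix p assume "p \<in> Q \<eta>"
    then have "p \<in> P" by (simp add: Q_def)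
    then show "S \<inter> E p = small_items p s \<epsilon> \<inter> E p"
      using early[of p] sub[of p] by (auto simp: S_def small_items_def)
  qed
  have sum_w: "(\<Sum>i\<in>S. w i \<eta> * f i) = (\<Sum>p\<in>Q \<eta>. \<Sum>i\<in>\<Lambda> p. f i)" for f \<eta>
    unfolding w_def sum_card_member[OF finS finQ]
  proof (intro sum.cong refl)
    fix p assume "p \<in> Q \<eta>"
    then have "p \<in> P" by (simp add: Q_def)
    \<comment> \<open>Late items are small, so intersecting with \<open>S\<close> drops none of
      them.\<close>
    then show "S \<inter> \<Lambda> p = \<Lambda> p"
      using late[of p] sub[of p] by (auto simp: S_def small_items_def)
  qed

  have cover_large: "real (num_large I s \<epsilon> z) \<le> (\<Sum>c\<in>C. u c * real (cfg_alpha c z))" for z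
  proof -
    have "num_large I s \<epsilon> z = card (\<Union>p\<in>P. {i \<in> large_items p s \<epsilon>. s i = z})"
      using part by (auto simp: num_large_def large_items_def partition_on_def
          intro!: arg_cong[where f = card])
    \<comment> \<open>The covering constraint is an inequality, so the union bound suffices.\<close>
    also have "\<dots> \<le> (\<Sum>p\<in>P. num_large p s \<epsilon> z)"
      unfolding num_large_def using finP by (rule card_UN_le)
    finally show ?thesis
      unfolding sum_u by (simp add: cf_def bin_config_def flip: of_nat_sum)
  qed
  have cover_small: "1 \<le> (\<Sum>\<eta>\<in>H. v i \<eta> + w i \<eta>)" if "i \<in> S" for i
  proof -
    have "i \<in> \<Union>P" using that partition_onD1[OF part] by (simp add: S_def small_items_def)
    then obtain p where p: "p \<in> P" "i \<in> p" by blast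
    \<comment> \<open>The index at which item \<open>i\<close> is covered is the \<gamma> of the bin
      containing it.\<close>
    define \<eta> where "\<eta> = cfg_gamma (cf p)"
    have "p \<in> Q \<eta>" using p by (simp add: Q_def \<eta>_def)
    moreover have "i \<in> E p \<or> i \<in> \<Lambda> p" using p(2) by (simp add: E_def \<Lambda>_def late_items_def)
    ultimately have "card {p \<in> Q \<eta>. i \<in> E p} > 0 \<or> card {p \<in> Q \<eta>. i \<in> \<Lambda> p} > 0"
      using finQ by (auto simp: card_gt_0_iff)
    then have "1 \<le> v i \<eta> + w i \<eta>" by (auto simp: v_def w_def)
    also have "\<dots> \<le> (\<Sum>\<eta>\<in>H. v i \<eta> + w i \<eta>)"
      using cfH[OF p(1)] finH by (intro member_le_sum) (auto simp: \<eta>_def v_def w_def)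
    finally show ?thesis .
  qed
  have "(\<Sum>i\<in>S. v i \<eta> * s i) \<le> (\<Sum>c\<in>{c \<in> C. cfg_gamma c = \<eta>}. u c * config_beta Z U \<epsilon> c)"
    for \<eta>
    unfolding sum_v sum_uQ
  proof (rule sum_mono)
    fix p assume "p \<in> Q \<eta>"
    then have "p \<in> P" by (simp add: Q_def)
    note b = bin[OF this]
    show "sum s (small_items p s \<epsilon> \<inter> E p) \<le> config_beta Z U \<epsilon> (cf p)"
      unfolding E_def cf_def using b(1-4) finZ b(5) by (rule bin_config_beta)
  qed
  moreover have "(\<Sum>i\<in>S. w i \<eta> * modified_size s U k i)
      \<le> (\<Sum>c\<in>{c \<in> C. cfg_gamma c = \<eta>}.
            u c * of_bool (cfg_gamma' c) * (real (cfg_gamma c) + 1) * \<epsilon>)" for \<eta>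
    unfolding sum_w mult.assoc sum_uQ
  proof (rule sum_mono)
    fix p assume "p \<in> Q \<eta>"
    then have "p \<in> P" by (simp add: Q_def)
    note b = bin[OF this]
    show "sum (modified_size s U k) (\<Lambda> p)
        \<le> of_bool (cfg_gamma' (cf p)) * ((real (cfg_gamma (cf p)) + 1) * \<epsilon>)"
      unfolding \<Lambda>_def cf_def mult.assoc[symmetric] using b(1-4) by (rule bin_config_late)
  qed
  moreover have "(\<Sum>c\<in>{c \<in> C. cfg_gamma c = \<eta>}. u c * (\<Sum>z\<in>Z. real (cfg_alpha c z)))
        + (\<Sum>i\<in>S. v i \<eta>)
      \<le> (\<Sum>c\<in>{c \<in> C. cfg_gamma c = \<eta>}. u c * real (cfg_delta c) * real k)" for \<eta>
    \<comment> \<open>With weight 1, \<open>sum_v\<close> counts small early items per bin, so the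
      constraint splits into one inequality for each bin.\<close>
    unfolding mult.assoc sum_uQ sum_v[of \<eta> "\<lambda>_. 1", unfolded mult_1_right]
      sum.distrib[symmetric]
  proof (rule sum_mono)
    fix p assume "p \<in> Q \<eta>"
    then have "p \<in> P" by (simp add: Q_def)
    note b = bin[OF this]
    show "(\<Sum>z\<in>Z. real (cfg_alpha (cf p) z)) + (\<Sum>i\<in>small_items p s \<epsilon> \<inter> E p. 1)
        \<le> real (cfg_delta (cf p)) * real k"
      unfolding E_def cf_def using b(1-4) finZ b(5) by (rule bin_config_count)
  qed
  ultimately have "config_LP_feasible I s U k \<epsilon> u v w"
    unfolding config_LP_feasible_def Let_def Z_def[symmetric] S_def[symmetric] H_def[symmetric] C_def[symmetric]
    using cover_large cover_small by (simp add: u_def v_def w_def)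
  moreover have "config_LP_cost I s U \<epsilon> u \<le> real B"
    \<comment> \<open>With the constant 1, \<open>sum_u\<close> says that the multiplicities add up
      to the number of bins.\<close>
    using sum_u[of "\<lambda>_. 1"] assms(11) by (simp add: config_LP_cost_def C_def Z_def)
  ultimately show ?thesis by blast
qed

end
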